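(* Let $X$ and $Y$ be operator spaces. If $X$ spherically-completely coarsely (resp. coarse Lipschitzly) embeds into $Y$, then the bounded subsets of $X$ almost completely coarsely (resp. coarse Lipschitzly) embed into $Y$.
   Context: An operator space is a closed linear subspace $X$ of $\mathcal{B}(H)$ for some complex Hilbert space $H$. For $n\in\mathbb{N}$, $\mathrm{M}_n(X)$ is the space of $n\times n$ matrices over $X$ with the norm inherited from $\mathrm{M}_n(\mathcal{B}(H))\cong\mathcal{B}(H^{\oplus n})$. For a (not necessarily linear) map $f$ defined on a set $A$, its $n$-th amplification $f_n$ is defined on $\mathrm{M}_n(A)$ by $f_n([x_{ij}])=[f(x_{ij})]$. $B_E$ and $\partial B_E$ denote the closed unit ball and the unit sphere of a Banach space $E$. For a sequence $\bar f=(F^n\colon A_n\to B_n)_n$ of maps between metric spaces $(A_n,d_n)$, $(B_n,\partial_n)$, put $\omega_{\bar f}(t)=\sup_n\sup\{\partial_n(F^n(x),F^n(y))\mid d_n(x,y)\le t\}$ and $\rho_{\bar f}(t)=\inf_n\inf\{\partial_n(F^n(x),F^n(y))\mid d_n(x,y)\ge t\}$ (with $\inf\emptyset=\infty$). The maps are equi-coarse embeddings if $\omega_{\bar f}(t)<\infty$ for all $t\ge0$ and $\lim_{t\to\infty}\rho_{\bar f}(t)=\infty$; they are equi-coarse Lipschitz embeddings if there is $L>0$ with $\omega_{\bar f}(t)\le Lt+L$ and $\rho_{\bar f}(t)\ge L^{-1}t-L$ for all $t\ge0$. A map $F\colon\mathrm{M}_n(X)\to\mathrm{M}_n(Y)$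 is a spherical amplification if for all $r\ge0$ there is a map $f\colon X\to Y$ with $F\restriction_{r\cdot\partial B_{\mathrm{M}_n(X)}}=f_n\restriction_{r\cdot\partial B_{\mathrm{M}_n(X)}}$. $X$ spherically-completely coarsely (resp. coarse Lipschitzly) embeds into $Y$ if there is a sequence $(F^n\colon\mathrm{M}_n(X)\to\mathrm{M}_n(Y))_n$ of spherical amplifications which are equi-coarse (resp. equi-coarse Lipschitz) embeddings. The bounded subsets of $X$ almost completely coarsely (resp. coarse Lipschitzly) embed into $Y$ if there is a sequence of maps $(f^n\colon n\cdot B_X\to Y)_n$ such that the restricted amplifications $(f^n_n\restriction_{n\cdot B_{\mathrm{M}_n(X)}}\colon n\cdot B_{\mathrm{M}_n(X)}\to\mathrm{M}_n(Y))_n$ are equi-coarse (resp. equi-coarse Lipschitz) embeddings. *)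

theory Defs
  imports "HOL-Analysis.Analysis" "Jordan_Normal_Form.Matrix"
begin

section \<open>Complex Hilbert spaces\<close>

text \<open>The inner product is conjugate-linear in the first and linear in the second argument;
  definiteness is part of the last axiom, completeness comes from \<open>banach\<close>.\<close>

class complex_hilbert_space = banach +
  fixes scaleC :: "complex \<Rightarrow> 'a \<Rightarrow> 'a"
    and cinner :: "'a \<Rightarrow> 'a \<Rightarrow> complex"
  assumes scaleC_add_right: "scaleC c (x + y) = scaleC c x + scaleC c y"
    and scaleC_add_left: "scaleC (c + d) x = scaleC c x + scaleC d x"
    and scaleC_scaleC: "scaleC c (scaleC d x) = scaleC (c * d) x"
    and scaleC_of_real: "scaleC (complex_of_real r) x = scaleR r x"
    and cinner_commute: "cinner x y = cnj (cinner y x)"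
    and cinner_add_right: "cinner x (y + z) = cinner x y + cinner x z"
    and cinner_scaleC_right: "cinner x (scaleC c y) = c * cinner x y"
    and cinner_self: "cinner x x = complex_of_real ((norm x)\<^sup>2)"

instantiation complex :: complex_hilbert_space
begin
definition "scaleC c (x::complex) = c * x"
definition "cinner (x::complex) y = cnj x * y"
instance
  by standard
    (auto simp: scaleC_complex_def cinner_complex_def algebra_simps scaleR_conv_of_real
      complex_norm_square[symmetric])
end

lemma norm_scaleC: "norm (scaleC c x) = cmod c * norm (x::'a::complex_hilbert_space)"
proof -
  have "complex_of_real ((norm (scaleC c x))\<^sup>2) = cinner (scaleC c x) (scaleC c x)"
    by (simp only: cinner_self)
  also have "\<dots> = c * cnj c * cinner x x"
    by (metis cinner_commute cinner_scaleC_right complex_cnj_mult mult.assoc)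
  also have "\<dots> = complex_of_real ((cmod c * norm x)\<^sup>2)"
    by (simp add: cinner_self complex_norm_square[symmetric] power_mult_distrib)
  finally have "(norm (scaleC c x))\<^sup>2 = (cmod c * norm x)\<^sup>2"
    using of_real_eq_iff by blast
  then show ?thesis by (simp add: power2_eq_iff_nonneg)
qed

lemma bounded_linear_scaleC: "bounded_linear (scaleC c :: 'a \<Rightarrow> 'a::complex_hilbert_space)"
proof (rule bounded_linear_intro[where K = "cmod c"])
  fix x y :: 'a and r :: real
  show "scaleC c (x + y) = scaleC c x + scaleC c y" by (rule scaleC_add_right)
  show "scaleC c (r *\<^sub>R x) = r *\<^sub>R scaleC c x"
    by (metis scaleC_of_real scaleC_scaleC mult.commute)
  show "norm (scaleC c x) \<le> norm x * cmod c" by (simp add: norm_scaleC mult.commute)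
qed


section \<open>Operator spaces and their matrix norms\<close>

text \<open>\<open>'h \<Rightarrow>\<^sub>L 'h\<close> consists of the bounded real-linear operators; \<open>\<B>(H)\<close> is its subset of
  complex-linear ones, with the same operator norm.\<close>

definition complex_operators :: "('h::complex_hilbert_space \<Rightarrow>\<^sub>L 'h) set" where
  "complex_operators =
     {T. \<forall>c x. blinfun_apply T (scaleC c x) = scaleC c (blinfun_apply T x)}"

lift_definition scaleC_op ::
  "complex \<Rightarrow> ('h::complex_hilbert_space \<Rightarrow>\<^sub>L 'h) \<Rightarrow> ('h \<Rightarrow>\<^sub>L 'h)"
  is "\<lambda>c T x. scaleC c (T x)"
  by (rule bounded_linear_compose[OF bounded_linear_scaleC])

definition operator_space :: "('h::complex_hilbert_space \<Rightarrow>\<^sub>L 'h) set \<Rightarrow> bool" where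
  "operator_space X \<longleftrightarrow>
     X \<subseteq> complex_operators \<and> closed X \<and> 0 \<in> X \<and>
     (\<forall>S\<in>X. \<forall>T\<in>X. S + T \<in> X) \<and> (\<forall>c. \<forall>T\<in>X. scaleC_op c T \<in> X)"

definition matrices :: "nat \<Rightarrow> 'a set \<Rightarrow> 'a mat set" where
  "matrices n X = {A \<in> carrier_mat n n. \<forall>i<n. \<forall>j<n. A $$ (i, j) \<in> X}"

text \<open>The operator norm of a matrix acting on the Hilbert space direct sum, whose elements are
  the tuples \<open>\<xi>\<close> with norm \<open>L2_set (\<lambda>j. norm (\<xi> j)) {..<n}\<close>.\<close>

definition mat_norm :: "('h::complex_hilbert_space \<Rightarrow>\<^sub>L 'h) mat \<Rightarrow> real" where
  "mat_norm A =
     (SUP \<xi>\<in>{\<xi>. L2_set (\<lambda>j. norm (\<xi> j)) {..<dim_col A} \<le> 1}.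
        L2_set (\<lambda>i. norm (\<Sum>j<dim_col A. blinfun_apply (A $$ (i, j)) (\<xi> j))) {..<dim_row A})"

lemma mat_norm_bdd_above:
  fixes A :: "('h::complex_hilbert_space \<Rightarrow>\<^sub>L 'h) mat"
  shows "bdd_above
    ((\<lambda>\<xi>. L2_set (\<lambda>i. norm (\<Sum>j<dim_col A. blinfun_apply (A $$ (i, j)) (\<xi> j))) {..<dim_row A}) `
      {\<xi>. L2_set (\<lambda>j. norm (\<xi> j)) {..<dim_col A} \<le> 1})"
proof (rule bdd_aboveI2)
  fix \<xi> :: "nat \<Rightarrow> 'h"
  assume "\<xi> \<in> {\<xi>. L2_set (\<lambda>j. norm (\<xi> j)) {..<dim_col A} \<le> 1}"
  then have *: "norm (\<xi> j) \<le> 1" if "j < dim_col A" for j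
    using member_le_L2_set[of "{..<dim_col A}" j "\<lambda>j. norm (\<xi> j)"] that by simp
  have "L2_set (\<lambda>i. norm (\<Sum>j<dim_col A. blinfun_apply (A $$ (i, j)) (\<xi> j))) {..<dim_row A}
      \<le> (\<Sum>i<dim_row A. norm (\<Sum>j<dim_col A. blinfun_apply (A $$ (i, j)) (\<xi> j)))"
    by (rule L2_set_le_sum) simp
  also have "\<dots> \<le> (\<Sum>i<dim_row A. \<Sum>j<dim_col A. norm (A $$ (i, j)))"
  proof (rule sum_mono, rule sum_norm_le)
    fix i j assume "j \<in> {..<dim_col A}"
    then show "norm (blinfun_apply (A $$ (i, j)) (\<xi> j)) \<le> norm (A $$ (i, j))"
      using norm_blinfun[of "A $$ (i, j)" "\<xi> j"] *[of j]
      by (meson lessThan_iff mult_left_le norm_ge_zero order_trans)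
  qed
  finally show "L2_set (\<lambda>i. norm (\<Sum>j<dim_col A. blinfun_apply (A $$ (i, j)) (\<xi> j))) {..<dim_row A}
      \<le> (\<Sum>i<dim_row A. \<Sum>j<dim_col A. norm (A $$ (i, j)))" .
qed

definition mat_dist ::
  "('h::complex_hilbert_space \<Rightarrow>\<^sub>L 'h) mat \<Rightarrow> ('h \<Rightarrow>\<^sub>L 'h) mat \<Rightarrow> real" where
  "mat_dist A B = mat_norm (A - B)"

definition scaled_ball :: "real \<Rightarrow> ('h::complex_hilbert_space \<Rightarrow>\<^sub>L 'h) set \<Rightarrow> ('h \<Rightarrow>\<^sub>L 'h) set" where
  "scaled_ball r X = (\<lambda>x. r *\<^sub>R x) ` {x \<in> X. norm x \<le> 1}"

definition scaled_mat_ball ::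
  "real \<Rightarrow> nat \<Rightarrow> ('h::complex_hilbert_space \<Rightarrow>\<^sub>L 'h) set \<Rightarrow> ('h \<Rightarrow>\<^sub>L 'h) mat set" where
  "scaled_mat_ball r n X = map_mat (\<lambda>x. r *\<^sub>R x) ` {A \<in> matrices n X. mat_norm A \<le> 1}"

definition scaled_mat_sphere ::
  "real \<Rightarrow> nat \<Rightarrow> ('h::complex_hilbert_space \<Rightarrow>\<^sub>L 'h) set \<Rightarrow> ('h \<Rightarrow>\<^sub>L 'h) mat set" where
  "scaled_mat_sphere r n X = map_mat (\<lambda>x. r *\<^sub>R x) ` {A \<in> matrices n X. mat_norm A = 1}"


section \<open>Equi-coarse embeddings\<close>

text \<open>A sequence, indexed by \<open>n \<ge> 1\<close>, of maps \<open>F n\<close> from \<open>A n\<close> (with distance \<open>d\<close>) to \<open>B n\<close>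
  (with distance \<open>e\<close>). The moduli take values in \<open>[0, \<infinity>]\<close>, so an empty infimum is \<open>\<infinity>\<close>.\<close>

definition expansion_modulus ::
  "('a \<Rightarrow> 'a \<Rightarrow> real) \<Rightarrow> ('b \<Rightarrow> 'b \<Rightarrow> real) \<Rightarrow> (nat \<Rightarrow> 'a set) \<Rightarrow> (nat \<Rightarrow> 'a \<Rightarrow> 'b) \<Rightarrow> real \<Rightarrow> ennreal"
  where
  "expansion_modulus d e A F t =
     (SUP n\<in>{1..}. Sup {ennreal (e (F n x) (F n y)) | x y. x \<in> A n \<and> y \<in> A n \<and> d x y \<le> t})"

definition compression_modulus ::
  "('a \<Rightarrow> 'a \<Rightarrow> real) \<Rightarrow> ('b \<Rightarrow> 'b \<Rightarrow> real) \<Rightarrow> (nat \<Rightarrow> 'a set) \<Rightarrow> (nat \<Rightarrow> 'a \<Rightarrow> 'b) \<Rightarrow> real \<Rightarrow> ennreal"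
  where
  "compression_modulus d e A F t =
     (INF n\<in>{1..}. Inf {ennreal (e (F n x) (F n y)) | x y. x \<in> A n \<and> y \<in> A n \<and> d x y \<ge> t})"

definition equi_coarse_embeddings ::
  "('a \<Rightarrow> 'a \<Rightarrow> real) \<Rightarrow> ('b \<Rightarrow> 'b \<Rightarrow> real) \<Rightarrow>
    (nat \<Rightarrow> 'a set) \<Rightarrow> (nat \<Rightarrow> 'b set) \<Rightarrow> (nat \<Rightarrow> 'a \<Rightarrow> 'b) \<Rightarrow> bool" where
  "equi_coarse_embeddings d e A B F \<longleftrightarrow>
     (\<forall>n\<ge>1. F n \<in> A n \<rightarrow> B n) \<and>
     (\<forall>t\<ge>0. expansion_modulus d e A F t < \<infinity>) \<and>
     (compression_modulus d e A F \<longlongrightarrow> \<infinity>) at_top"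

text \<open>In the lower bound \<open>ennreal\<close> replaces a negative \<open>t / L - L\<close> by \<open>0\<close>, which is harmless.\<close>

definition equi_coarse_Lipschitz_embeddings ::
  "('a \<Rightarrow> 'a \<Rightarrow> real) \<Rightarrow> ('b \<Rightarrow> 'b \<Rightarrow> real) \<Rightarrow>
    (nat \<Rightarrow> 'a set) \<Rightarrow> (nat \<Rightarrow> 'b set) \<Rightarrow> (nat \<Rightarrow> 'a \<Rightarrow> 'b) \<Rightarrow> bool" where
  "equi_coarse_Lipschitz_embeddings d e A B F \<longleftrightarrow>
     (\<forall>n\<ge>1. F n \<in> A n \<rightarrow> B n) \<and>
     (\<exists>L>0. \<forall>t\<ge>0. expansion_modulus d e A F t \<le> ennreal (L * t + L) \<and>
                   compression_modulus d e A F t \<ge> ennreal (inverse L * t - L))"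


section \<open>Embeddings between operator spaces\<close>

text \<open>The \<open>n\<close>-th amplification of \<open>f\<close> is \<open>map_mat f\<close> on \<open>n \<times> n\<close> matrices.\<close>

definition spherical_amplification ::
  "nat \<Rightarrow> ('h::complex_hilbert_space \<Rightarrow>\<^sub>L 'h) set \<Rightarrow> ('k::complex_hilbert_space \<Rightarrow>\<^sub>L 'k) set \<Rightarrow>
    (('h \<Rightarrow>\<^sub>L 'h) mat \<Rightarrow> ('k \<Rightarrow>\<^sub>L 'k) mat) \<Rightarrow> bool" where
  "spherical_amplification n X Y F \<longleftrightarrow>
     F \<in> matrices n X \<rightarrow> matrices n Y \<and>
     (\<forall>r\<ge>0. \<exists>f. f \<in> X \<rightarrow> Y \<and> (\<forall>A\<in>scaled_mat_sphere r n X. F A = map_mat f A))"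

definition spherically_completely_coarsely_embeds ::
  "('h::complex_hilbert_space \<Rightarrow>\<^sub>L 'h) set \<Rightarrow> ('k::complex_hilbert_space \<Rightarrow>\<^sub>L 'k) set \<Rightarrow> bool" where
  "spherically_completely_coarsely_embeds X Y \<longleftrightarrow>
     (\<exists>F. (\<forall>n\<ge>1. spherical_amplification n X Y (F n)) \<and>
          equi_coarse_embeddings mat_dist mat_dist
            (\<lambda>n. matrices n X) (\<lambda>n. matrices n Y) F)"

definition spherically_completely_coarse_Lipschitzly_embeds ::
  "('h::complex_hilbert_space \<Rightarrow>\<^sub>L 'h) set \<Rightarrow> ('k::complex_hilbert_space \<Rightarrow>\<^sub>L 'k) set \<Rightarrow> bool" where
  "spherically_completely_coarse_Lipschitzly_embeds X Y \<longleftrightarrow>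
     (\<exists>F. (\<forall>n\<ge>1. spherical_amplification n X Y (F n)) \<and>
          equi_coarse_Lipschitz_embeddings mat_dist mat_dist
            (\<lambda>n. matrices n X) (\<lambda>n. matrices n Y) F)"

definition bounded_subsets_almost_completely_coarsely_embed ::
  "('h::complex_hilbert_space \<Rightarrow>\<^sub>L 'h) set \<Rightarrow> ('k::complex_hilbert_space \<Rightarrow>\<^sub>L 'k) set \<Rightarrow> bool" where
  "bounded_subsets_almost_completely_coarsely_embed X Y \<longleftrightarrow>
     (\<exists>f. (\<forall>n\<ge>1. f n \<in> scaled_ball (real n) X \<rightarrow> Y) \<and>
          equi_coarse_embeddings mat_dist mat_dist
            (\<lambda>n. scaled_mat_ball (real n) n X) (\<lambda>n. matrices n Y) (\<lambda>n. map_mat (f n)))"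

definition bounded_subsets_almost_completely_coarse_Lipschitzly_embed ::
  "('h::complex_hilbert_space \<Rightarrow>\<^sub>L 'h) set \<Rightarrow> ('k::complex_hilbert_space \<Rightarrow>\<^sub>L 'k) set \<Rightarrow> bool" where
  "bounded_subsets_almost_completely_coarse_Lipschitzly_embed X Y \<longleftrightarrow>
     (\<exists>f. (\<forall>n\<ge>1. f n \<in> scaled_ball (real n) X \<rightarrow> Y) \<and>
          equi_coarse_Lipschitz_embeddings mat_dist mat_dist
            (\<lambda>n. scaled_mat_ball (real n) n X) (\<lambda>n. matrices n Y) (\<lambda>n. map_mat (f n)))"

end

theory Submission
  imports Defs
begin

text \<open>Suppose \<open>X\<close> contains a unit vector \<open>x\<close> and let \<open>F\<close> be a sequence of spherical
  amplifications. A matrix \<open>A\<close> in the ball of radius \<open>n\<close> of \<open>M\<^sub>n(X)\<close> need not lie on any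
  prescribed sphere, but the diagonal sum \<open>A \<oplus> n x\<close> in \<open>M\<^sub>n\<^sub>+\<^sub>1(X)\<close> has norm exactly \<open>n\<close>, because
  the norm of a diagonal sum is the maximum of the norms (\<open>mat_norm_diag_sum\<close>). On the sphere of
  radius \<open>n\<close> the map \<open>F (n + 1)\<close> is the amplification of a single map \<open>f\<close>, and this \<open>f\<close> is taken
  as the \<open>n\<close>-th map. Two such sums differ by \<open>(A - B) \<oplus> 0\<close>, and so do their images: both have
  \<open>f 0\<close> off the diagonal and \<open>f (n x)\<close> in the corner, so these entries cancel. Hence
  \<open>A \<mapsto> A \<oplus> n x\<close> is isometric and carries the distances of images under the amplification of \<open>f\<close>
  to the distances of images under \<open>F (n + 1)\<close> (\<open>distances_realized\<close>). Both moduli of the new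
  sequence are therefore controlled by those of \<open>F\<close> without any loss
  (\<open>expansion_modulus_mono\<close>, \<open>compression_modulus_mono\<close>), which settles the coarse and the coarse
  Lipschitz case together.

  Only \<open>X = {0}\<close> has no unit vector; then every ball is a single point and constant maps do.\<close>

section \<open>The matrix norm\<close>

lemma mat_norm_ge_0: "0 \<le> mat_norm A"
proof -
  have "0 \<le> L2_set (\<lambda>i. norm (\<Sum>j<dim_col A. blinfun_apply (A $$ (i, j)) 0)) {..<dim_row A}"
    by simp
  also have "\<dots> \<le> mat_norm A"
    unfolding mat_norm_def
    by (rule cSUP_upper2[OF mat_norm_bdd_above, where x = "\<lambda>_. 0"]) (auto simp: L2_set_def)
  finally show ?thesis .
qed

text \<open>The supremum runs over tuples of norm at most one; dividing by the norm extends the bound to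
  all tuples, and only zero entries contribute when that norm vanishes.\<close>

lemma mat_norm_bound:
  "L2_set (\<lambda>i. norm (\<Sum>j<dim_col A. blinfun_apply (A $$ (i, j)) (\<xi> j))) {..<dim_row A}
     \<le> mat_norm A * L2_set (\<lambda>j. norm (\<xi> j)) {..<dim_col A}"
proof (cases "L2_set (\<lambda>j. norm (\<xi> j)) {..<dim_col A} = 0")
  case True
  then have "\<xi> j = 0" if "j < dim_col A" for j
    using that by (simp add: L2_set_eq_0_iff)
  then show ?thesis using True by (simp add: L2_set_def)
next
  case False
  define l where "l = L2_set (\<lambda>j. norm (\<xi> j)) {..<dim_col A}"
  have l: "l > 0"
    using False L2_set_nonneg[of "\<lambda>j. norm (\<xi> j)"] unfolding l_def by (simp add: less_le)
  define \<eta> where "\<eta> = (\<lambda>j. inverse l *\<^sub>R \<xi> j)"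
  have "L2_set (\<lambda>j. norm (\<eta> j)) {..<dim_col A} = inverse l * l"
    using l unfolding l_def[symmetric] \<eta>_def
    by (simp add: L2_set_right_distrib[symmetric] l_def[symmetric])
  then have "L2_set (\<lambda>i. norm (\<Sum>j<dim_col A. blinfun_apply (A $$ (i, j)) (\<eta> j))) {..<dim_row A}
      \<le> mat_norm A"
    unfolding mat_norm_def using l
    by (intro cSUP_upper[OF _ mat_norm_bdd_above]) simp
  moreover have
    "L2_set (\<lambda>i. norm (\<Sum>j<dim_col A. blinfun_apply (A $$ (i, j)) (\<eta> j))) {..<dim_row A}
      = inverse l *
        L2_set (\<lambda>i. norm (\<Sum>j<dim_col A. blinfun_apply (A $$ (i, j)) (\<xi> j))) {..<dim_row A}"
    using l unfolding \<eta>_def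
    by (simp add: blinfun.scaleR_right scaleR_right.sum[symmetric] L2_set_right_distrib)
  ultimately show ?thesis
    using l by (simp add: l_def[symmetric] field_simps)
qed

lemma mat_norm_least:
  assumes "\<And>\<xi>. L2_set (\<lambda>j. norm (\<xi> j)) {..<dim_col A} \<le> 1 \<Longrightarrow>
    L2_set (\<lambda>i. norm (\<Sum>j<dim_col A. blinfun_apply (A $$ (i, j)) (\<xi> j))) {..<dim_row A} \<le> c"
  shows "mat_norm A \<le> c"
proof -
  have "(\<lambda>_. 0) \<in> {\<xi>::nat \<Rightarrow> 'a. L2_set (\<lambda>j. norm (\<xi> j)) {..<dim_col A} \<le> 1}"
    by (simp add: L2_set_def)
  then have "{\<xi>::nat \<Rightarrow> 'a. L2_set (\<lambda>j. norm (\<xi> j)) {..<dim_col A} \<le> 1} \<noteq> {}"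
    by (rule ex_in_conv[THEN iffD1, OF exI])
  then show ?thesis
    unfolding mat_norm_def by (rule cSUP_least) (simp add: assms)
qed

lemma mat_dist_self: "mat_dist A A = 0"
proof -
  have "mat_norm (A - A) \<le> 0"
    by (rule mat_norm_least) (simp add: L2_set_def)
  then show ?thesis
    unfolding mat_dist_def using mat_norm_ge_0[of "A - A"] by linarith
qed

section \<open>Diagonal sums\<close>

definition diag_sum :: "nat \<Rightarrow> 'a::zero mat \<Rightarrow> 'a \<Rightarrow> 'a mat" where
  "diag_sum n A x = mat (Suc n) (Suc n)
     (\<lambda>(i, j). if i < n \<and> j < n then A $$ (i, j) else if i = n \<and> j = n then x else 0)"

lemma L2_set_lessThan_Suc:
  "L2_set f {..<Suc n} = sqrt ((L2_set f {..<n})\<^sup>2 + (f n)\<^sup>2)"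
  by (simp add: L2_set_def sum_nonneg add.commute)

text \<open>\<open>A \<oplus> x\<close> acts on the two orthogonal summands separately.\<close>

lemma L2_set_diag_sum:
  fixes A :: "('h::complex_hilbert_space \<Rightarrow>\<^sub>L 'h) mat"
  assumes "A \<in> carrier_mat n n"
  shows "L2_set (\<lambda>i. norm (\<Sum>j<Suc n. blinfun_apply (diag_sum n A x $$ (i, j)) (\<xi> j))) {..<Suc n}
    = sqrt ((L2_set (\<lambda>i. norm (\<Sum>j<n. blinfun_apply (A $$ (i, j)) (\<xi> j))) {..<n})\<^sup>2
            + (norm (blinfun_apply x (\<xi> n)))\<^sup>2)"
proof -
  have "L2_set (\<lambda>i. norm (\<Sum>j<Suc n. blinfun_apply (diag_sum n A x $$ (i, j)) (\<xi> j))) {..<n}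
      = L2_set (\<lambda>i. norm (\<Sum>j<n. blinfun_apply (A $$ (i, j)) (\<xi> j))) {..<n}"
    by (rule L2_set_cong) (simp_all add: diag_sum_def)
  moreover have "(\<Sum>j<Suc n. blinfun_apply (diag_sum n A x $$ (n, j)) (\<xi> j))
      = blinfun_apply x (\<xi> n)"
    by (simp add: diag_sum_def)
  ultimately show ?thesis
    by (simp only: L2_set_lessThan_Suc)
qed

lemma mat_norm_diag_sum:
  fixes A :: "('h::complex_hilbert_space \<Rightarrow>\<^sub>L 'h) mat"
  assumes A: "A \<in> carrier_mat n n"
  shows "mat_norm (diag_sum n A x) = max (mat_norm A) (norm x)"
proof (rule antisym)
  let ?D = "diag_sum n A x"
  have dims: "dim_row ?D = Suc n" "dim_col ?D = Suc n" "dim_row A = n" "dim_col A = n"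
    using A by (auto simp: diag_sum_def)
  define M where "M = max (mat_norm A) (norm x)"
  have M: "0 \<le> M" "mat_norm A \<le> M" "norm x \<le> M"
    using mat_norm_ge_0[of A] by (auto simp: M_def)
  show "mat_norm ?D \<le> max (mat_norm A) (norm x)"
    unfolding M_def[symmetric]
  proof (rule mat_norm_least, unfold dims)
    fix \<xi> :: "nat \<Rightarrow> 'h"
    assume \<xi>: "L2_set (\<lambda>j. norm (\<xi> j)) {..<Suc n} \<le> 1"
    let ?l = "L2_set (\<lambda>j. norm (\<xi> j)) {..<n}"
    let ?a = "L2_set (\<lambda>i. norm (\<Sum>j<n. blinfun_apply (A $$ (i, j)) (\<xi> j))) {..<n}"
    have "?a \<le> mat_norm A * ?l"
      using mat_norm_bound[of A \<xi>] by (simp add: dims)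
    also have "\<dots> \<le> M * ?l"
      using M by (intro mult_right_mono) simp_all
    finally have a: "?a \<le> M * ?l" .
    have "norm (blinfun_apply x (\<xi> n)) \<le> norm x * norm (\<xi> n)"
      by (rule norm_blinfun)
    also have "\<dots> \<le> M * norm (\<xi> n)"
      using M by (intro mult_right_mono) simp_all
    finally have b: "norm (blinfun_apply x (\<xi> n)) \<le> M * norm (\<xi> n)" .
    have "sqrt (?a\<^sup>2 + (norm (blinfun_apply x (\<xi> n)))\<^sup>2)
        \<le> sqrt ((M * ?l)\<^sup>2 + (M * norm (\<xi> n))\<^sup>2)"
      using a b by (intro real_sqrt_le_mono add_mono power_mono) simp_all
    also have "\<dots> = M * sqrt (?l\<^sup>2 + (norm (\<xi> n))\<^sup>2)"
      using M by (simp add: power_mult_distrib distrib_left[symmetric] real_sqrt_mult)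
    also have "\<dots> = M * L2_set (\<lambda>j. norm (\<xi> j)) {..<Suc n}"
      by (simp only: L2_set_lessThan_Suc)
    also have "\<dots> \<le> M"
      using \<xi> M by (simp add: mult_left_le)
    finally show "L2_set (\<lambda>i. norm (\<Sum>j<Suc n. blinfun_apply (?D $$ (i, j)) (\<xi> j))) {..<Suc n}
        \<le> M"
      by (simp only: L2_set_diag_sum[OF A])
  qed
  \<comment> \<open>For the converse, this bound is tested on tuples supported on one of the two summands.\<close>
  have D: "sqrt ((L2_set (\<lambda>i. norm (\<Sum>j<n. blinfun_apply (A $$ (i, j)) (\<xi> j))) {..<n})\<^sup>2
            + (norm (blinfun_apply x (\<xi> n)))\<^sup>2)
      \<le> mat_norm ?D * sqrt ((L2_set (\<lambda>j. norm (\<xi> j)) {..<n})\<^sup>2 + (norm (\<xi> n))\<^sup>2)" for \<xi>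
    using mat_norm_bound[of ?D \<xi>] unfolding dims L2_set_diag_sum[OF A]
    by (simp only: L2_set_lessThan_Suc)
  have "mat_norm A \<le> mat_norm ?D"
  proof (rule mat_norm_least, unfold dims)
    fix \<xi> :: "nat \<Rightarrow> 'h"
    assume \<xi>: "L2_set (\<lambda>j. norm (\<xi> j)) {..<n} \<le> 1"
    have "L2_set (\<lambda>i. norm (\<Sum>j<n. blinfun_apply (A $$ (i, j)) (\<xi> j))) {..<n}
        \<le> mat_norm ?D * L2_set (\<lambda>j. norm (\<xi> j)) {..<n}"
      using D[of "\<xi>(n := 0)"] by (simp add: L2_set_def sum_nonneg cong: sum.cong_simp)
    also have "\<dots> \<le> mat_norm ?D"
      using \<xi> mat_norm_ge_0[of ?D] by (simp add: mult_left_le)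
    finally show "L2_set (\<lambda>i. norm (\<Sum>j<n. blinfun_apply (A $$ (i, j)) (\<xi> j))) {..<n}
        \<le> mat_norm ?D" .
  qed
  moreover have "norm x \<le> mat_norm ?D"
  proof (rule norm_blinfun_bound[OF mat_norm_ge_0])
    fix v
    show "norm (blinfun_apply x v) \<le> mat_norm ?D * norm v"
      using D[of "(\<lambda>_. 0)(n := v)"] by (simp add: L2_set_def cong: sum.cong_simp)
  qed
  ultimately show "max (mat_norm A) (norm x) \<le> mat_norm ?D" by simp
qed

lemma mat_dist_diag_sum:
  fixes A B :: "('h::complex_hilbert_space \<Rightarrow>\<^sub>L 'h) mat"
  assumes "A \<in> carrier_mat n n" "B \<in> carrier_mat n n"
  shows "mat_dist (diag_sum n A x) (diag_sum n B x) = mat_dist A B"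
proof -
  have "diag_sum n A x - diag_sum n B x = diag_sum n (A - B) 0"
    using assms by (intro eq_matI) (auto simp: diag_sum_def)
  moreover have "A - B \<in> carrier_mat n n"
    using assms by auto
  ultimately show ?thesis
    by (simp add: mat_dist_def mat_norm_diag_sum mat_norm_ge_0)
qed

text \<open>Since \<open>f 0\<close> may be nonzero, the image of a diagonal sum is in general no diagonal sum; only
  the difference of two images is one.\<close>

lemma mat_dist_map_diag_sum:
  fixes A B :: "'a::zero mat" and f :: "'a \<Rightarrow> 'k::complex_hilbert_space \<Rightarrow>\<^sub>L 'k"
  assumes "A \<in> carrier_mat n n" "B \<in> carrier_mat n n"
  shows "mat_dist (map_mat f (diag_sum n A x)) (map_mat f (diag_sum n B x))
    = mat_dist (map_mat f A) (map_mat f B)"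
proof -
  have "map_mat f (diag_sum n A x) - map_mat f (diag_sum n B x)
      = diag_sum n (map_mat f A - map_mat f B) 0"
    using assms by (intro eq_matI) (auto simp: diag_sum_def)
  moreover have "map_mat f A - map_mat f B \<in> carrier_mat n n"
    using assms by auto
  ultimately show ?thesis
    by (simp add: mat_dist_def mat_norm_diag_sum mat_norm_ge_0)
qed

section \<open>Balls and spheres in operator spaces\<close>

lemma operator_space_scaleR:
  assumes "operator_space X" "T \<in> X"
  shows "r *\<^sub>R T \<in> X"
proof -
  have "scaleC_op (complex_of_real r) T = r *\<^sub>R T"
    by (rule blinfun_eqI) (simp add: scaleC_op.rep_eq scaleC_of_real blinfun.scaleR_left)
  then show ?thesis
    using assms unfolding operator_space_def by metis
qed

lemma scaled_ball_subset: "operator_space X \<Longrightarrow> scaled_ball r X \<subseteq> X"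
  by (auto simp: scaled_ball_def operator_space_scaleR)

lemma scaled_mat_ball_subset: "operator_space X \<Longrightarrow> scaled_mat_ball r n X \<subseteq> matrices n X"
  by (auto simp: scaled_mat_ball_def matrices_def operator_space_scaleR)

lemma map_mat_matrices: "f \<in> X \<rightarrow> Y \<Longrightarrow> map_mat f \<in> matrices n X \<rightarrow> matrices n Y"
  by (auto simp: matrices_def)

lemma diag_sum_matrices:
  assumes "A \<in> matrices n X" "x \<in> X" "0 \<in> X"
  shows "diag_sum n A x \<in> matrices (Suc n) X"
  using assms by (auto simp: matrices_def diag_sum_def)

text \<open>The spheres are scaled unit spheres, so the scaling has to be pulled out of the sum.\<close>

lemma diag_sum_scaled_mat_sphere:
  assumes "operator_space X" "A \<in> scaled_mat_ball r n X" "x \<in> X" "norm x = 1"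
  shows "diag_sum n A (r *\<^sub>R x) \<in> scaled_mat_sphere r (Suc n) X"
proof -
  obtain C where C: "C \<in> matrices n X" "mat_norm C \<le> 1" "A = map_mat (\<lambda>x. r *\<^sub>R x) C"
    using assms(2) by (auto simp: scaled_mat_ball_def)
  have carrier: "C \<in> carrier_mat n n"
    using C(1) by (simp add: matrices_def)
  have "0 \<in> X"
    using assms(1) by (simp add: operator_space_def)
  then have "diag_sum n C x \<in> matrices (Suc n) X"
    using C(1) assms(3) by (rule diag_sum_matrices[rotated -1])
  moreover have "mat_norm (diag_sum n C x) = 1"
    using mat_norm_diag_sum[OF carrier, of x] C(2) assms(4) by simp
  moreover have "diag_sum n A (r *\<^sub>R x) = map_mat (\<lambda>x. r *\<^sub>R x) (diag_sum n C x)"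
    using carrier unfolding C(3) by (intro eq_matI) (auto simp: diag_sum_def)
  ultimately show ?thesis
    unfolding scaled_mat_sphere_def by blast
qed

lemma operator_space_unit_vector:
  assumes "operator_space X" "X \<noteq> {0}"
  obtains x where "x \<in> X" "norm x = 1"
proof -
  obtain y where y: "y \<in> X" "y \<noteq> 0"
    using assms by (auto simp: operator_space_def)
  show ?thesis
    using y by (intro that[of "inverse (norm y) *\<^sub>R y"])
      (auto intro: operator_space_scaleR[OF assms(1)])
qed

section \<open>Comparing the moduli\<close>

text \<open>If every pair of distances (before and after the map) that occurs for \<open>F n\<close> also occurs for
  \<open>G (\<phi> n)\<close>, then the supremum and infimum for \<open>F\<close> range over a smaller set than those for \<open>G\<close>.\<close>

lemma expansion_modulus_mono:
  assumes \<phi>: "\<And>n. 1 \<le> n \<Longrightarrow> 1 \<le> \<phi> n"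
    and realized: "\<And>n x y. \<lbrakk>1 \<le> n; x \<in> A n; y \<in> A n\<rbrakk> \<Longrightarrow>
      \<exists>x'\<in>B (\<phi> n). \<exists>y'\<in>B (\<phi> n). d' x' y' = d x y \<and> e' (G (\<phi> n) x') (G (\<phi> n) y') = e (F n x) (F n y)"
  shows "expansion_modulus d e A F t \<le> expansion_modulus d' e' B G t"
  unfolding expansion_modulus_def
proof (rule SUP_mono)
  fix n :: nat
  assume "n \<in> {1..}"
  then have n: "1 \<le> n" by simp
  show "\<exists>m\<in>{1..}. Sup {ennreal (e (F n x) (F n y)) |x y. x \<in> A n \<and> y \<in> A n \<and> d x y \<le> t}
      \<le> Sup {ennreal (e' (G m x) (G m y)) |x y. x \<in> B m \<and> y \<in> B m \<and> d' x y \<le> t}"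
  proof (rule bexI[where x = "\<phi> n"], rule Sup_subset_mono, safe)
    fix x y
    assume xy: "x \<in> A n" "y \<in> A n" "d x y \<le> t"
    obtain x' y' where "x' \<in> B (\<phi> n)" "y' \<in> B (\<phi> n)" "d' x' y' = d x y"
      "e' (G (\<phi> n) x') (G (\<phi> n) y') = e (F n x) (F n y)"
      using realized[OF n xy(1,2)] by blast
    with xy show "\<exists>x' y'. ennreal (e (F n x) (F n y)) = ennreal (e' (G (\<phi> n) x') (G (\<phi> n) y'))
        \<and> x' \<in> B (\<phi> n) \<and> y' \<in> B (\<phi> n) \<and> d' x' y' \<le> t"
      by (intro exI[of _ x'] exI[of _ y']) simp
  qed (use \<phi>[OF n] in simp)
qed

lemma compression_modulus_mono:
  assumes \<phi>: "\<And>n. 1 \<le> n \<Longrightarrow> 1 \<le> \<phi> n"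
    and realized: "\<And>n x y. \<lbrakk>1 \<le> n; x \<in> A n; y \<in> A n\<rbrakk> \<Longrightarrow>
      \<exists>x'\<in>B (\<phi> n). \<exists>y'\<in>B (\<phi> n). d' x' y' = d x y \<and> e' (G (\<phi> n) x') (G (\<phi> n) y') = e (F n x) (F n y)"
  shows "compression_modulus d' e' B G t \<le> compression_modulus d e A F t"
  unfolding compression_modulus_def
proof (rule INF_mono)
  fix n :: nat
  assume "n \<in> {1..}"
  then have n: "1 \<le> n" by simp
  show "\<exists>m\<in>{1..}. Inf {ennreal (e' (G m x) (G m y)) |x y. x \<in> B m \<and> y \<in> B m \<and> t \<le> d' x y}
      \<le> Inf {ennreal (e (F n x) (F n y)) |x y. x \<in> A n \<and> y \<in> A n \<and> t \<le> d x y}"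
  proof (rule bexI[where x = "\<phi> n"], rule Inf_superset_mono, safe)
    fix x y
    assume xy: "x \<in> A n" "y \<in> A n" "t \<le> d x y"
    obtain x' y' where "x' \<in> B (\<phi> n)" "y' \<in> B (\<phi> n)" "d' x' y' = d x y"
      "e' (G (\<phi> n) x') (G (\<phi> n) y') = e (F n x) (F n y)"
      using realized[OF n xy(1,2)] by blast
    with xy show "\<exists>x' y'. ennreal (e (F n x) (F n y)) = ennreal (e' (G (\<phi> n) x') (G (\<phi> n) y'))
        \<and> x' \<in> B (\<phi> n) \<and> y' \<in> B (\<phi> n) \<and> t \<le> d' x' y'"
      by (intro exI[of _ x'] exI[of _ y']) simp
  qed (use \<phi>[OF n] in simp)
qed

lemma equi_coarse_embeddings_mono:
  assumes "equi_coarse_embeddings d' e' B B' G"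
    and "\<And>n. 1 \<le> n \<Longrightarrow> F n \<in> A n \<rightarrow> A' n"
    and "\<And>t. expansion_modulus d e A F t \<le> expansion_modulus d' e' B G t"
    and "\<And>t. compression_modulus d' e' B G t \<le> compression_modulus d e A F t"
  shows "equi_coarse_embeddings d e A A' F"
proof -
  have "(compression_modulus d' e' B G \<longlongrightarrow> \<infinity>) at_top"
    using assms(1) by (simp add: equi_coarse_embeddings_def)
  then have "(compression_modulus d e A F \<longlongrightarrow> \<infinity>) at_top"
    by (rule tendsto_sandwich[OF _ _ _ tendsto_const, rotated 2])
      (auto intro: always_eventually assms(4))
  moreover have "expansion_modulus d e A F t < \<infinity>" if "0 \<le> t" for t
    using assms(1) that le_less_trans[OF assms(3)] by (simp add: equi_coarse_embeddings_def)
  ultimately show ?thesis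
    unfolding equi_coarse_embeddings_def using assms(2) by blast
qed

lemma equi_coarse_Lipschitz_embeddings_mono:
  assumes "equi_coarse_Lipschitz_embeddings d' e' B B' G"
    and "\<And>n. 1 \<le> n \<Longrightarrow> F n \<in> A n \<rightarrow> A' n"
    and "\<And>t. expansion_modulus d e A F t \<le> expansion_modulus d' e' B G t"
    and "\<And>t. compression_modulus d' e' B G t \<le> compression_modulus d e A F t"
  shows "equi_coarse_Lipschitz_embeddings d e A A' F"
  using assms unfolding equi_coarse_Lipschitz_embeddings_def by (meson order_trans)

section \<open>From spherical amplifications to maps on balls\<close>

text \<open>Only the sphere of radius \<open>n\<close> is used at stage \<open>n\<close>, so each \<open>f n\<close> comes from a single radius;
  the extra row and column, which pushes \<open>A\<close> onto that sphere, is why \<open>f n\<close> is compared with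
  \<open>F (Suc n)\<close> instead of \<open>F n\<close>. For \<open>X = {0}\<close> all distances vanish, and the zero matrix paired
  with itself realizes them.\<close>

lemma distances_realized:
  assumes X: "operator_space X" and Y: "operator_space Y"
    and F: "\<And>n. 1 \<le> n \<Longrightarrow> spherical_amplification n X Y (F n)"
  obtains f where "\<And>n. f n \<in> X \<rightarrow> Y"
    and "\<And>n A B. \<lbrakk>A \<in> scaled_mat_ball (real n) n X; B \<in> scaled_mat_ball (real n) n X\<rbrakk> \<Longrightarrow>
      \<exists>A'\<in>matrices (Suc n) X. \<exists>B'\<in>matrices (Suc n) X.
        mat_dist A' B' = mat_dist A B \<and>
        mat_dist (F (Suc n) A') (F (Suc n) B') = mat_dist (map_mat (f n) A) (map_mat (f n) B)"
proof (cases "X = {0}")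
  case True
  have singleton: "A = B" if "A \<in> scaled_mat_ball (real n) n X" "B \<in> scaled_mat_ball (real n) n X" for n A B
  proof -
    have "A \<in> matrices n {0}" "B \<in> matrices n {0}"
      using that scaled_mat_ball_subset[OF X, of "real n" n] True by auto
    then show ?thesis
      by (intro eq_matI) (auto simp: matrices_def)
  qed
  have zero: "0\<^sub>m (Suc n) (Suc n) \<in> matrices (Suc n) X" for n
    using True by (simp add: matrices_def)
  show ?thesis
  proof (rule that)
    show "(\<lambda>_. 0) \<in> X \<rightarrow> Y" for n :: nat
      using Y by (simp add: operator_space_def)
    fix n A B
    assume "A \<in> scaled_mat_ball (real n) n X" "B \<in> scaled_mat_ball (real n) n X"
    then have "A = B"
      by (rule singleton)
    with zero[of n] show "\<exists>A'\<in>matrices (Suc n) X. \<exists>B'\<in>matrices (Suc n) X.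
        mat_dist A' B' = mat_dist A B \<and>
        mat_dist (F (Suc n) A') (F (Suc n) B') = mat_dist (map_mat (\<lambda>_. 0) A) (map_mat (\<lambda>_. 0) B)"
      by (metis mat_dist_self)
  qed
next
  case False
  obtain x where x: "x \<in> X" "norm x = 1"
    using operator_space_unit_vector[OF X False] .
  have "\<forall>n. \<exists>f. f \<in> X \<rightarrow> Y \<and>
      (\<forall>A\<in>scaled_mat_sphere (real n) (Suc n) X. F (Suc n) A = map_mat f A)"
    using F by (simp add: spherical_amplification_def)
  then obtain f where f: "\<And>n. f n \<in> X \<rightarrow> Y"
    "\<And>n A. A \<in> scaled_mat_sphere (real n) (Suc n) X \<Longrightarrow> F (Suc n) A = map_mat (f n) A"
    by metis
  show ?thesis
  proof (rule that[OF f(1)])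
    fix n A B
    assume AB: "A \<in> scaled_mat_ball (real n) n X" "B \<in> scaled_mat_ball (real n) n X"
    let ?x = "real n *\<^sub>R x"
    have matrices: "A \<in> matrices n X" "B \<in> matrices n X"
      using AB scaled_mat_ball_subset[OF X] by blast+
    then have carrier: "A \<in> carrier_mat n n" "B \<in> carrier_mat n n"
      by (simp_all add: matrices_def)
    have "0 \<in> X" "?x \<in> X"
      using X x(1) by (simp_all add: operator_space_def operator_space_scaleR[OF X])
    then have "diag_sum n A ?x \<in> matrices (Suc n) X" "diag_sum n B ?x \<in> matrices (Suc n) X"
      using matrices by (simp_all add: diag_sum_matrices)
    moreover have "F (Suc n) (diag_sum n A ?x) = map_mat (f n) (diag_sum n A ?x)"
      "F (Suc n) (diag_sum n B ?x) = map_mat (f n) (diag_sum n B ?x)"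
      using AB x by (simp_all add: f(2) diag_sum_scaled_mat_sphere[OF X])
    ultimately show "\<exists>A'\<in>matrices (Suc n) X. \<exists>B'\<in>matrices (Suc n) X.
        mat_dist A' B' = mat_dist A B \<and>
        mat_dist (F (Suc n) A') (F (Suc n) B') = mat_dist (map_mat (f n) A) (map_mat (f n) B)"
      using mat_dist_diag_sum[OF carrier] mat_dist_map_diag_sum[OF carrier] by metis
  qed
qed

lemma maps_on_balls_with_controlled_moduli:
  assumes X: "operator_space X" and Y: "operator_space Y"
    and F: "\<And>n. 1 \<le> n \<Longrightarrow> spherical_amplification n X Y (F n)"
  obtains f where "\<And>n. f n \<in> scaled_ball (real n) X \<rightarrow> Y"
    and "\<And>n. map_mat (f n) \<in> scaled_mat_ball (real n) n X \<rightarrow> matrices n Y"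
    and "\<And>t. expansion_modulus mat_dist mat_dist
        (\<lambda>n. scaled_mat_ball (real n) n X) (\<lambda>n. map_mat (f n)) t
      \<le> expansion_modulus mat_dist mat_dist (\<lambda>n. matrices n X) F t"
    and "\<And>t. compression_modulus mat_dist mat_dist (\<lambda>n. matrices n X) F t
      \<le> compression_modulus mat_dist mat_dist
        (\<lambda>n. scaled_mat_ball (real n) n X) (\<lambda>n. map_mat (f n)) t"
proof -
  obtain f where f: "\<And>n. f n \<in> X \<rightarrow> Y"
    and realized:
      "\<And>n A B. \<lbrakk>A \<in> scaled_mat_ball (real n) n X; B \<in> scaled_mat_ball (real n) n X\<rbrakk> \<Longrightarrow>
      \<exists>A'\<in>matrices (Suc n) X. \<exists>B'\<in>matrices (Suc n) X.
        mat_dist A' B' = mat_dist A B \<and>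
        mat_dist (F (Suc n) A') (F (Suc n) B') = mat_dist (map_mat (f n) A) (map_mat (f n) B)"
    using distances_realized[OF assms] by blast
  show ?thesis
  proof (rule that)
    show "f n \<in> scaled_ball (real n) X \<rightarrow> Y" for n
      using f scaled_ball_subset[OF X] by blast
    show "map_mat (f n) \<in> scaled_mat_ball (real n) n X \<rightarrow> matrices n Y" for n
      using map_mat_matrices[OF f] scaled_mat_ball_subset[OF X] by blast
  qed (rule expansion_modulus_mono[where \<phi> = Suc] compression_modulus_mono[where \<phi> = Suc];
      use realized in simp)+
qed

theorem proposition5p8:
  fixes X :: "('h::complex_hilbert_space \<Rightarrow>\<^sub>L 'h) set"
    and Y :: "('k::complex_hilbert_space \<Rightarrow>\<^sub>L 'k) set"
  assumes "operator_space X" and "operator_space Y"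
  shows "(spherically_completely_coarsely_embeds X Y \<longrightarrow>
            bounded_subsets_almost_completely_coarsely_embed X Y) \<and>
         (spherically_completely_coarse_Lipschitzly_embeds X Y \<longrightarrow>
            bounded_subsets_almost_completely_coarse_Lipschitzly_embed X Y)"
proof (intro conjI impI)
  assume "spherically_completely_coarsely_embeds X Y"
  then obtain F where F: "\<And>n. 1 \<le> n \<Longrightarrow> spherical_amplification n X Y (F n)"
    "equi_coarse_embeddings mat_dist mat_dist (\<lambda>n. matrices n X) (\<lambda>n. matrices n Y) F"
    unfolding spherically_completely_coarsely_embeds_def by blast
  show "bounded_subsets_almost_completely_coarsely_embed X Y"
  proof (rule maps_on_balls_with_controlled_moduli[OF assms F(1)])
    fix f
    assume f: "\<And>n. f n \<in> scaled_ball (real n) X \<rightarrow> Y"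
      "\<And>n. map_mat (f n) \<in> scaled_mat_ball (real n) n X \<rightarrow> matrices n Y"
      and moduli: "\<And>t. expansion_modulus mat_dist mat_dist
          (\<lambda>n. scaled_mat_ball (real n) n X) (\<lambda>n. map_mat (f n)) t
        \<le> expansion_modulus mat_dist mat_dist (\<lambda>n. matrices n X) F t"
      "\<And>t. compression_modulus mat_dist mat_dist (\<lambda>n. matrices n X) F t
        \<le> compression_modulus mat_dist mat_dist
          (\<lambda>n. scaled_mat_ball (real n) n X) (\<lambda>n. map_mat (f n)) t"
    show ?thesis
      unfolding bounded_subsets_almost_completely_coarsely_embed_def
      using f(1) equi_coarse_embeddings_mono[OF F(2) f(2) moduli] by blast
  qed
next
  assume "spherically_completely_coarse_Lipschitzly_embeds X Y"
  then obtain F where F: "\<And>n. 1 \<le> n \<Longrightarrow> spherical_amplification n X Y (F n)"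
    "equi_coarse_Lipschitz_embeddings mat_dist mat_dist (\<lambda>n. matrices n X) (\<lambda>n. matrices n Y) F"
    unfolding spherically_completely_coarse_Lipschitzly_embeds_def by blast
  show "bounded_subsets_almost_completely_coarse_Lipschitzly_embed X Y"
  proof (rule maps_on_balls_with_controlled_moduli[OF assms F(1)])
    fix f
    assume f: "\<And>n. f n \<in> scaled_ball (real n) X \<rightarrow> Y"
      "\<And>n. map_mat (f n) \<in> scaled_mat_ball (real n) n X \<rightarrow> matrices n Y"
      and moduli: "\<And>t. expansion_modulus mat_dist mat_dist
          (\<lambda>n. scaled_mat_ball (real n) n X) (\<lambda>n. map_mat (f n)) t
        \<le> expansion_modulus mat_dist mat_dist (\<lambda>n. matrices n X) F t"
      "\<And>t. compression_modulus mat_dist mat_dist (\<lambda>n. matrices n X) F t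
        \<le> compression_modulus mat_dist mat_dist
          (\<lambda>n. scaled_mat_ball (real n) n X) (\<lambda>n. map_mat (f n)) t"
    show ?thesis
      unfolding bounded_subsets_almost_completely_coarse_Lipschitzly_embed_def
      using f(1) equi_coarse_Lipschitz_embeddings_mono[OF F(2) f(2) moduli] by blast
  qed
qed

end
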